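(* The logic $\mathrm{DL\text{-}SM}$ is decidable; that is, the satisfiability problem (equivalently, the validity problem) for $\mathcal L_{\mathrm{DL\text{-}SM}}(\mathit{Atm},\mathit{Agt})$-formulas is decidable.
   Context: $\mathit{Atm}$ is a countable set of atomic propositions and $\mathit{Agt}=\{1,\dots,n\}$ a finite set of agents. Each agent $i$ has the action repertoire $\mathit{Act}_i=\{\Uparrow_i,\Downarrow_i,\Leftarrow_i,\Rightarrow_i,\mathit{nil}_i\}$; the set of joint actions is $\Delta=\prod_{i\in\mathit{Agt}}\mathit{Act}_i$, and $\delta_i$ is the $i$-th component of $\delta\in\Delta$. The language $\mathcal L_{\mathrm{DL\text{-}SM}}(\mathit{Atm},\mathit{Agt})$ is: spatial programs $\alpha ::= \Uparrow \mid \Downarrow \mid \Rightarrow \mid \Leftarrow \mid \alpha;\alpha' \mid \alpha\cup\alpha' \mid ?\varphi$; motion programs $\beta ::= \delta \mid \beta;\beta' \mid \beta\cup\beta' \mid ?\varphi$ with $\delta\in\Delta$; formulas $\varphi ::= p \mid \mathsf h_i \mid \neg\varphi \mid \varphi\wedge\psi \mid [\alpha]\varphi \mid [\beta]\varphi$ with $p\in\mathit{Atm}$, $i\in\mathit{Agt}$. A spatial model is $M=(\mathcal P,\mathcal V)$ with $\mathcal P:\mathit{Agt}\to\mathbb Z\times\mathbb Z$ and $\mathcal V:\mathbb Z\times\mathbb Z\to 2^{\mathit{Atm}}$; $\mathbf M$ is the set of all spatial models. By parallel induction: for spatial programs, in a given model $M$, $(x,y)R_\Uparrow(x,y+1)$,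 $(x,y)R_\Downarrow(x,y-1)$, $(x,y)R_\Rightarrow(x+1,y)$, $(x,y)R_\Leftarrow(x-1,y)$ (and no other pairs), $R_{\alpha_1;\alpha_2}=R_{\alpha_1}\circ R_{\alpha_2}$ (first $R_{\alpha_1}$, then $R_{\alpha_2}$), $R_{\alpha_1\cup\alpha_2}=R_{\alpha_1}\cup R_{\alpha_2}$, $R_{?\varphi}=\{((x,y),(x,y)):M,(x,y)\models\varphi\}$. For motion programs and each position $(x,y)$, the relation $R_\beta^{(x,y)}\subseteq\mathbf M\times\mathbf M$ is: $(M,M')\in R_\delta^{(x,y)}$ iff $\mathcal V'=\mathcal V$ and for every $i\in\mathit{Agt}$, $\mathcal P'(i)$ is obtained from $\mathcal P(i)=(u,v)$ as $(u,v+1)$ if $\delta_i=\Uparrow_i$, $(u,v-1)$ if $\delta_i=\Downarrow_i$, $(u+1,v)$ if $\delta_i=\Rightarrow_i$, $(u-1,v)$ if $\delta_i=\Leftarrow_i$, $(u,v)$ if $\delta_i=\mathit{nil}_i$; $R^{(x,y)}_{\beta_1;\beta_2}=R^{(x,y)}_{\beta_1}\circ R^{(x,y)}_{\beta_2}$; $R^{(x,y)}_{\beta_1\cup\beta_2}=R^{(x,y)}_{\beta_1}\cup R^{(x,y)}_{\beta_2}$; $R^{(x,y)}_{?\varphi}=\{(M,M):M,(x,y)\models\varphi\}$. Truth: $M,(x,y)\models p$ iff $p\in\mathcal V(x,y)$; $M,(x,y)\models\mathsf h_i$ iff $\mathcal P(i)=(x,y)$; Booleans as usual; $M,(x,y)\models[\alpha]\varphi$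 iff $M,(x',y')\models\varphi$ whenever $(x,y)R_\alpha(x',y')$; $M,(x,y)\models[\beta]\varphi$ iff $M',(x,y)\models\varphi$ whenever $M\,R_\beta^{(x,y)}M'$. A formula is valid if true in every spatial model at every position, and satisfiable if its negation is not valid. *)

theory Defs
  imports Main "HOL-Library.Nat_Bijection"
begin

section \<open>Syntax\<close>

text \<open>The type parameters \<open>'atm\<close> and \<open>'agt\<close> are the atomic propositions and the agents. The
  repertoires \<open>Act\<^sub>i\<close> are copies of one five-element type, so a joint action is a function from agents
  to \<open>act\<close>. Spatial and motion programs are separate types, hence the two box constructors.\<close>

datatype act = MUp | MDown | MLeft | MRight | MNil

datatype ('atm, 'agt) fm =
    Atom 'atm
  | Here 'agt
  | Neg "('atm, 'agt) fm"
  | Conj "('atm, 'agt) fm" "('atm, 'agt) fm"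
  | SBox "('atm, 'agt) sprog" "('atm, 'agt) fm"
  | MBox "('atm, 'agt) mprog" "('atm, 'agt) fm"
and ('atm, 'agt) sprog =
    SUp | SDown | SRight | SLeft
  | SSeq "('atm, 'agt) sprog" "('atm, 'agt) sprog"
  | SChoice "('atm, 'agt) sprog" "('atm, 'agt) sprog"
  | STest "('atm, 'agt) fm"
and ('atm, 'agt) mprog =
    Joint "'agt \<Rightarrow> act"
  | MSeq "('atm, 'agt) mprog" "('atm, 'agt) mprog"
  | MChoice "('atm, 'agt) mprog" "('atm, 'agt) mprog"
  | MTest "('atm, 'agt) fm"


section \<open>Semantics\<close>

type_synonym pos = "int \<times> int"

type_synonym ('atm, 'agt) model = "('agt \<Rightarrow> pos) \<times> (pos \<Rightarrow> 'atm set)"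

fun move :: "act \<Rightarrow> pos \<Rightarrow> pos" where
  "move MUp (u, v) = (u, v + 1)"
| "move MDown (u, v) = (u, v - 1)"
| "move MRight (u, v) = (u + 1, v)"
| "move MLeft (u, v) = (u - 1, v)"
| "move MNil (u, v) = (u, v)"

primrec sat :: "('atm, 'agt) fm \<Rightarrow> ('atm, 'agt) model \<Rightarrow> pos \<Rightarrow> bool"
  and srel :: "('atm, 'agt) sprog \<Rightarrow> ('atm, 'agt) model \<Rightarrow> (pos \<times> pos) set"
  and mrel :: "('atm, 'agt) mprog \<Rightarrow> pos \<Rightarrow>
        (('atm, 'agt) model \<times> ('atm, 'agt) model) set" where
  "sat (Atom p) M w \<longleftrightarrow> p \<in> snd M w"
| "sat (Here i) M w \<longleftrightarrow> fst M i = w"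
| "sat (Neg \<phi>) M w \<longleftrightarrow> \<not> sat \<phi> M w"
| "sat (Conj \<phi> \<psi>) M w \<longleftrightarrow> sat \<phi> M w \<and> sat \<psi> M w"
| "sat (SBox \<alpha> \<phi>) M w \<longleftrightarrow> (\<forall>w'. (w, w') \<in> srel \<alpha> M \<longrightarrow> sat \<phi> M w')"
| "sat (MBox \<beta> \<phi>) M w \<longleftrightarrow> (\<forall>M'. (M, M') \<in> mrel \<beta> w \<longrightarrow> sat \<phi> M' w)"
| "srel SUp M = {((x, y), (x, y + 1)) | x y. True}"
| "srel SDown M = {((x, y), (x, y - 1)) | x y. True}"
| "srel SRight M = {((x, y), (x + 1, y)) | x y. True}"
| "srel SLeft M = {((x, y), (x - 1, y)) | x y. True}"
| "srel (SSeq \<alpha>1 \<alpha>2) M = srel \<alpha>1 M O srel \<alpha>2 M"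
| "srel (SChoice \<alpha>1 \<alpha>2) M = srel \<alpha>1 M \<union> srel \<alpha>2 M"
| "srel (STest \<phi>) M = {(w, w) | w. sat \<phi> M w}"
| "mrel (Joint \<delta>) w =
     {(M, M') | M M'. snd M' = snd M \<and> (\<forall>i. fst M' i = move (\<delta> i) (fst M i))}"
| "mrel (MSeq \<beta>1 \<beta>2) w = mrel \<beta>1 w O mrel \<beta>2 w"
| "mrel (MChoice \<beta>1 \<beta>2) w = mrel \<beta>1 w \<union> mrel \<beta>2 w"
| "mrel (MTest \<phi>) w = {(M, M) | M. sat \<phi> M w}"

definition valid :: "('atm, 'agt) fm \<Rightarrow> bool" where
  "valid \<phi> \<longleftrightarrow> (\<forall>M w. sat \<phi> M w)"

definition satisfiable :: "('atm, 'agt) fm \<Rightarrow> bool" where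
  "satisfiable \<phi> \<longleftrightarrow> \<not> valid (Neg \<phi>)"


section \<open>Recursive functions and decidable problems\<close>

text \<open>The total recursive functions: the least class containing the zero functions, the successor
  and the projections and closed under composition, primitive recursion and minimization of regular
  functions. In \<open>recursive_fn n f\<close> only the values of \<open>f\<close> on lists of length \<open>n\<close> are meaningful.
  The first argument is the recursion (respectively the search) variable.\<close>

inductive recursive_fn :: "nat \<Rightarrow> (nat list \<Rightarrow> nat) \<Rightarrow> bool" where
  zero: "recursive_fn n (\<lambda>xs. 0)"
| succ: "recursive_fn 1 (\<lambda>xs. Suc (xs ! 0))"
| proj: "i < n \<Longrightarrow> recursive_fn n (\<lambda>xs. xs ! i)"
| comp: "\<lbrakk>recursive_fn (length gs) f; \<forall>g \<in> set gs. recursive_fn n g\<rbrakk>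
    \<Longrightarrow> recursive_fn n (\<lambda>xs. f (map (\<lambda>g. g xs) gs))"
| prim_rec: "\<lbrakk>recursive_fn n f; recursive_fn (n + 2) g\<rbrakk>
    \<Longrightarrow> recursive_fn (n + 1)
          (\<lambda>xs. rec_nat (f (tl xs)) (\<lambda>k r. g (k # r # tl xs)) (hd xs))"
| minim: "\<lbrakk>recursive_fn (n + 1) f; \<forall>xs. length xs = n \<longrightarrow> (\<exists>k. f (k # xs) = 0)\<rbrakk>
    \<Longrightarrow> recursive_fn n (\<lambda>xs. LEAST k. f (k # xs) = 0)"

text \<open>A problem \<open>P\<close> on instances coded by natural numbers is decidable if some total recursive
  function, given the code of an instance, answers 1 or 0 according to whether \<open>P\<close> holds. Nothing is
  required on numbers that do not code an instance.\<close>

definition decidable :: "('x \<Rightarrow> nat) \<Rightarrow> ('x \<Rightarrow> bool) \<Rightarrow> bool" where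
  "decidable code P \<longleftrightarrow>
     (\<exists>f. recursive_fn 1 f \<and> (\<forall>x. f [code x] = (if P x then 1 else 0)))"


section \<open>Goedel numbering of formulas\<close>

text \<open>The numbering is relative to a coding \<open>c\<close> of the atoms and a listing \<open>ags\<close> of all agents: an
  agent is coded by its position in \<open>ags\<close>, a joint action by the list of its components in that
  order.\<close>

primrec act_code :: "act \<Rightarrow> nat" where
  "act_code MUp = 0"
| "act_code MDown = 1"
| "act_code MLeft = 2"
| "act_code MRight = 3"
| "act_code MNil = 4"

definition agent_code :: "'agt list \<Rightarrow> 'agt \<Rightarrow> nat" where
  "agent_code ags i = length (takeWhile (\<lambda>j. j \<noteq> i) ags)"

definition joint_code :: "'agt list \<Rightarrow> ('agt \<Rightarrow> act) \<Rightarrow> nat" where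
  "joint_code ags \<delta> = list_encode (map (\<lambda>i. act_code (\<delta> i)) ags)"

primrec fm_code :: "('atm \<Rightarrow> nat) \<Rightarrow> 'agt list \<Rightarrow> ('atm, 'agt) fm \<Rightarrow> nat"
  and sprog_code :: "('atm \<Rightarrow> nat) \<Rightarrow> 'agt list \<Rightarrow> ('atm, 'agt) sprog \<Rightarrow> nat"
  and mprog_code :: "('atm \<Rightarrow> nat) \<Rightarrow> 'agt list \<Rightarrow> ('atm, 'agt) mprog \<Rightarrow> nat" where
  "fm_code c ags (Atom p) = prod_encode (0, c p)"
| "fm_code c ags (Here i) = prod_encode (1, agent_code ags i)"
| "fm_code c ags (Neg \<phi>) = prod_encode (2, fm_code c ags \<phi>)"
| "fm_code c ags (Conj \<phi> \<psi>) =
     prod_encode (3, prod_encode (fm_code c ags \<phi>, fm_code c ags \<psi>))"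
| "fm_code c ags (SBox \<alpha> \<phi>) =
     prod_encode (4, prod_encode (sprog_code c ags \<alpha>, fm_code c ags \<phi>))"
| "fm_code c ags (MBox \<beta> \<phi>) =
     prod_encode (5, prod_encode (mprog_code c ags \<beta>, fm_code c ags \<phi>))"
| "sprog_code c ags SUp = prod_encode (0, 0)"
| "sprog_code c ags SDown = prod_encode (0, 1)"
| "sprog_code c ags SRight = prod_encode (0, 2)"
| "sprog_code c ags SLeft = prod_encode (0, 3)"
| "sprog_code c ags (SSeq \<alpha>1 \<alpha>2) =
     prod_encode (1, prod_encode (sprog_code c ags \<alpha>1, sprog_code c ags \<alpha>2))"
| "sprog_code c ags (SChoice \<alpha>1 \<alpha>2) =
     prod_encode (2, prod_encode (sprog_code c ags \<alpha>1, sprog_code c ags \<alpha>2))"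
| "sprog_code c ags (STest \<phi>) = prod_encode (3, fm_code c ags \<phi>)"
| "mprog_code c ags (Joint \<delta>) = prod_encode (0, joint_code ags \<delta>)"
| "mprog_code c ags (MSeq \<beta>1 \<beta>2) =
     prod_encode (1, prod_encode (mprog_code c ags \<beta>1, mprog_code c ags \<beta>2))"
| "mprog_code c ags (MChoice \<beta>1 \<beta>2) =
     prod_encode (2, prod_encode (mprog_code c ags \<beta>1, mprog_code c ags \<beta>2))"
| "mprog_code c ags (MTest \<phi>) = prod_encode (3, fm_code c ags \<phi>)"

lemma act_code_inj: "act_code a = act_code b \<longleftrightarrow> a = b"
  by (cases a; cases b) simp_all

lemma agent_code_inj:
  assumes "set ags = UNIV"
  shows "agent_code ags i = agent_code ags j \<longleftrightarrow> i = j"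
proof -
  have "xs ! length (takeWhile (\<lambda>j. j \<noteq> k) xs) = k" if "k \<in> set xs" for k :: 'a and xs
    using that by (induction xs) auto
  then have "ags ! agent_code ags k = k" for k
    using assms by (simp add: agent_code_def)
  then show ?thesis by metis
qed

lemma joint_code_inj:
  assumes "set ags = UNIV"
  shows "joint_code ags \<delta> = joint_code ags \<delta>' \<longleftrightarrow> \<delta> = \<delta>'"
  using assms by (auto simp: joint_code_def list_encode_eq act_code_inj)

lemma code_inj:
  assumes "inj c" "set ags = UNIV"
  shows "fm_code c ags \<phi> = fm_code c ags \<phi>' \<Longrightarrow> \<phi> = \<phi>'"
    and "sprog_code c ags \<alpha> = sprog_code c ags \<alpha>' \<Longrightarrow> \<alpha> = \<alpha>'"
    and "mprog_code c ags \<beta> = mprog_code c ags \<beta>' \<Longrightarrow> \<beta> = \<beta>'"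
proof (induction \<phi> and \<alpha> and \<beta> arbitrary: \<phi>' and \<alpha>' and \<beta>')
  case (Atom p) then show ?case using assms by (cases \<phi>') (auto dest: injD)
next
  case (Here i) then show ?case using assms by (cases \<phi>') (auto simp: agent_code_inj)
next
  case (Neg \<phi>) then show ?case by (cases \<phi>') auto
next
  case (Conj \<phi> \<psi>) then show ?case by (cases \<phi>') auto
next
  case (SBox \<alpha> \<phi>) then show ?case by (cases \<phi>') auto
next
  case (MBox \<beta> \<phi>) then show ?case by (cases \<phi>') auto
next
  case SUp then show ?case by (cases \<alpha>') auto
next
  case SDown then show ?case by (cases \<alpha>') auto
next
  case SRight then show ?case by (cases \<alpha>') auto
next
  case SLeft then show ?case by (cases \<alpha>') auto
next
  case (SSeq \<alpha>1 \<alpha>2) then show ?case by (cases \<alpha>') auto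
next
  case (SChoice \<alpha>1 \<alpha>2) then show ?case by (cases \<alpha>') auto
next
  case (STest \<phi>) then show ?case by (cases \<alpha>') auto
next
  case (Joint \<delta>) then show ?case using assms by (cases \<beta>') (auto simp: joint_code_inj)
next
  case (MSeq \<beta>1 \<beta>2) then show ?case by (cases \<beta>') auto
next
  case (MChoice \<beta>1 \<beta>2) then show ?case by (cases \<beta>') auto
next
  case (MTest \<phi>) then show ?case by (cases \<beta>') auto
qed

end

theory Submission
  imports Defs
begin

text \<open>Without iteration a formula inspects only a bounded neighbourhood of the position at which it
  is evaluated; agents outside can be moved anywhere outside, and the radius and the atoms involved
  are bounded by the code of the formula. So a satisfiable formula has a model, with the origin as
  the evaluation point, among those coded by the numbers up to a recursive bound. Model checking is
  done by a machine with success and failure continuations that rewrites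
  \<open>[\<alpha>;\<beta>]\<phi>\<close>, \<open>[\<alpha> \<union> \<beta>]\<phi>\<close> and \<open>[?\<psi>]\<phi>\<close> to boxes over smaller programs. Its transition function
  needs neither recursion on codes nor lists, and iterating it until it halts is an instance of
  minimization.\<close>

section \<open>Computable functions\<close>

text \<open>\<open>recursive_fn\<close> is sensitive to junk values on lists of the wrong length; this closure is not.\<close>

definition computable :: "nat \<Rightarrow> (nat list \<Rightarrow> nat) \<Rightarrow> bool" where
  "computable n f \<longleftrightarrow> (\<exists>g. recursive_fn n g \<and> (\<forall>xs. length xs = n \<longrightarrow> g xs = f xs))"

lemma computableI: "recursive_fn n f \<Longrightarrow> computable n f"
  by (auto simp: computable_def)

lemma computable_cong:
  assumes "\<And>xs. length xs = n \<Longrightarrow> f xs = g xs"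
  shows "computable n f \<longleftrightarrow> computable n g"
  using assms by (auto simp: computable_def)

lemma computable_comp:
  assumes f: "computable (length gs) f" and gs: "\<forall>g \<in> set gs. computable n g"
  shows "computable n (\<lambda>xs. f (map (\<lambda>g. g xs) gs))"
proof -
  obtain f' where f': "recursive_fn (length gs) f'" "\<And>xs. length xs = length gs \<Longrightarrow> f' xs = f xs"
    using f by (auto simp: computable_def)
  obtain G where G: "\<And>g. g \<in> set gs \<Longrightarrow> recursive_fn n (G g)"
      "\<And>g xs. g \<in> set gs \<Longrightarrow> length xs = n \<Longrightarrow> G g xs = g xs"
    using gs unfolding computable_def by metis
  have "recursive_fn n (\<lambda>xs. f' (map (\<lambda>g. g xs) (map G gs)))"
    using f'(1) G(1) by (intro recursive_fn.comp) auto
  moreover have "f' (map (\<lambda>g. g xs) (map G gs)) = f (map (\<lambda>g. g xs) gs)" if "length xs = n" for xs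
  proof -
    have "map (\<lambda>g. g xs) (map G gs) = map (\<lambda>g. g xs) gs"
      using G(2) that by simp
    then show ?thesis using f'(2) by (metis length_map)
  qed
  ultimately show ?thesis unfolding computable_def by blast
qed

lemma computable_nth: "i < n \<Longrightarrow> computable n (\<lambda>xs. xs ! i)"
  by (intro computableI recursive_fn.proj)

lemma computable_comp1:
  assumes "computable 1 (\<lambda>xs. F (xs ! 0))" "computable n a"
  shows "computable n (\<lambda>xs. F (a xs))"
  using computable_comp[of "[a]" "\<lambda>xs. F (xs ! 0)" n] assms by simp

lemma computable_comp2:
  assumes "computable 2 (\<lambda>xs. F (xs ! 0) (xs ! 1))" "computable n a" "computable n b"
  shows "computable n (\<lambda>xs. F (a xs) (b xs))"
  using computable_comp[of "[a, b]" "\<lambda>xs. F (xs ! 0) (xs ! 1)" n] assms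
  by (simp add: numeral_2_eq_2)

lemma computable_Suc: "computable n a \<Longrightarrow> computable n (\<lambda>xs. Suc (a xs))"
  by (rule computable_comp1[of Suc]) (intro computableI recursive_fn.succ)

lemma computable_const: "computable n (\<lambda>xs. k)"
  by (induction k) (auto intro: computableI recursive_fn.zero computable_Suc)

text \<open>\<open>prim_rec\<close> consumes the head of its argument list. Composing it with
  \<open>a\<close> followed by all projections lets the recursion run for \<open>a xs\<close> steps
  while the whole of \<open>xs\<close> stays available as parameters.\<close>

lemma computable_rec:
  assumes a: "computable n a" and b: "computable n b" and h: "computable (Suc (Suc n)) h"
  shows "computable n (\<lambda>xs. rec_nat (b xs) (\<lambda>k r. h (k # r # xs)) (a xs))"
proof -
  obtain b' where b': "recursive_fn n b'" "\<And>xs. length xs = n \<Longrightarrow> b' xs = b xs"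
    using b by (auto simp: computable_def)
  obtain h' where h': "recursive_fn (n + 2) h'" "\<And>xs. length xs = n + 2 \<Longrightarrow> h' xs = h xs"
    using h by (auto simp: computable_def)
  let ?F = "\<lambda>b h ys. rec_nat (b (tl ys)) (\<lambda>k r. h (k # r # tl ys)) (hd ys)"
  have "computable (n + 1) (?F b' h')"
    using b'(1) h'(1) by (intro computableI recursive_fn.prim_rec)
  then have *: "computable (n + 1) (?F b h)"
    by (subst computable_cong[of _ _ "?F b' h'"]) (auto simp: b'(2) h'(2))
  let ?gs = "a # map (\<lambda>i xs. xs ! i) [0..<n]"
  have "computable n (\<lambda>xs. ?F b h (map (\<lambda>g. g xs) ?gs))"
    by (rule computable_comp) (use * a in \<open>auto intro: computable_nth\<close>)
  moreover have "map (\<lambda>g. g xs) (map (\<lambda>i xs. xs ! i) [0..<n]) = xs" if "length xs = n"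
    for xs :: "nat list"
    using that map_nth[of xs] by (simp add: comp_def)
  ultimately show ?thesis
    by (subst (asm) computable_cong[where g = "\<lambda>xs. rec_nat (b xs) (\<lambda>k r. h (k # r # xs)) (a xs)"])
      simp_all
qed

lemma computable_least:
  assumes f: "computable (Suc n) f" and ex: "\<And>xs. length xs = n \<Longrightarrow> \<exists>k. f (k # xs) = 0"
  shows "computable n (\<lambda>xs. LEAST k. f (k # xs) = 0)"
proof -
  obtain f' where f': "recursive_fn (n + 1) f'" "\<And>xs. length xs = n + 1 \<Longrightarrow> f' xs = f xs"
    using f by (auto simp: computable_def)
  then have "recursive_fn n (\<lambda>xs. LEAST k. f' (k # xs) = 0)"
    using ex by (intro recursive_fn.minim) auto
  with f'(2) show ?thesis unfolding computable_def by (intro exI conjI) auto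
qed

lemma computable_funpow:
  assumes "computable 2 (\<lambda>xs. F (xs ! 0) (xs ! 1))"
    and "computable n p" "computable n a" "computable n b"
  shows "computable n (\<lambda>xs. (F (p xs) ^^ a xs) (b xs))"
proof -
  have rec: "(f ^^ k) x = rec_nat x (\<lambda>_ r. f r) k" for f :: "nat \<Rightarrow> nat" and k x
    by (induction k) auto
  \<comment> \<open>The recursion step sees counter and accumulator in front of the parameters;
    projections shifted by two make \<open>p\<close> skip them.\<close>
  have "computable (Suc (Suc n)) (\<lambda>ys. p (map (\<lambda>g. g ys) (map (\<lambda>i ys. ys ! (Suc (Suc i))) [0..<n])))"
    by (rule computable_comp) (use assms in \<open>auto intro: computable_nth\<close>)
  then have "computable (Suc (Suc n)) (\<lambda>ys. p (tl (tl ys)))"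
  proof (subst (asm) computable_cong)
    fix ys :: "nat list" assume "length ys = Suc (Suc n)"
    then obtain u v zs where "ys = u # v # zs" "length zs = n"
      by (auto simp: length_Suc_conv)
    then show "p (map (\<lambda>g. g ys) (map (\<lambda>i ys. ys ! (Suc (Suc i))) [0..<n])) = p (tl (tl ys))"
      using map_nth[of zs] by (simp add: comp_def)
  qed
  then have "computable (Suc (Suc n)) (\<lambda>ys. F (p (tl (tl ys))) (ys ! 1))"
    by (intro computable_comp2[of F, OF assms(1)] computable_nth) auto
  from computable_rec[OF assms(3,4) this] show ?thesis by (simp add: rec)
qed

lemma computable_funpow1:
  assumes "computable 1 (\<lambda>xs. f (xs ! 0))" "computable n a" "computable n b"
  shows "computable n (\<lambda>xs. (f ^^ a xs) (b xs))"
  by (rule computable_funpow[of "\<lambda>_. f", where p = "\<lambda>_. 0"])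
    (rule assms computable_const computable_comp1[of f] computable_nth | simp)+

lemma computable_if_zero:
  assumes "computable n a" "computable n b" "computable n d"
  shows "computable n (\<lambda>xs. if a xs = 0 then b xs else d xs)"
proof -
  \<comment> \<open>Entry 4 of \<open>k # r # xs\<close> is the third argument. The step ignores
    counter and accumulator, so any positive number of steps yields that argument.\<close>
  have "computable 3 (\<lambda>xs. rec_nat (xs ! 1) (\<lambda>k r. (k # r # xs) ! 4) (xs ! 0))"
    by (intro computable_rec computable_nth) auto
  then have "computable n (\<lambda>xs. rec_nat (b xs) (\<lambda>k r. d xs) (a xs))"
    using computable_comp[of "[a, b, d]" "\<lambda>xs. rec_nat (xs ! 1) (\<lambda>k r. (k # r # xs) ! 4) (xs ! 0)" n]
      assms by (simp add: eval_nat_numeral)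
  moreover have "rec_nat u (\<lambda>k r. v) m = (if m = 0 then u else v)" for u v m :: nat
    by (cases m) auto
  ultimately show ?thesis by simp
qed

lemma computable_add:
  assumes "computable n a" "computable n b"
  shows "computable n (\<lambda>xs. a xs + b xs)"
proof -
  have "(Suc ^^ k) m = k + m" for k m by (induction k) auto
  then show ?thesis
    using computable_funpow1[OF computable_Suc[OF computable_nth] assms] by simp
qed

lemma computable_diff:
  assumes "computable n a" "computable n b"
  shows "computable n (\<lambda>xs. a xs - b xs)"
proof -
  have "computable 1 (\<lambda>xs. rec_nat 0 (\<lambda>k r. (k # r # xs) ! 0) (xs ! 0))"
    by (intro computable_rec computable_nth computable_const) auto
  moreover have "rec_nat 0 (\<lambda>k r. k) m = m - 1" for m :: nat by (cases m) auto
  ultimately have pred: "computable 1 (\<lambda>xs. xs ! 0 - 1)" by simp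
  have "((\<lambda>x. x - 1) ^^ k) m = m - k" for k m :: nat by (induction k) auto
  then show ?thesis
    using computable_funpow1[OF pred assms(2,1)] by simp
qed

lemma computable_if_less:
  assumes "computable n a" "computable n a'" "computable n b" "computable n d"
  shows "computable n (\<lambda>xs. if a xs < a' xs then b xs else d xs)"
proof -
  have "computable n (\<lambda>xs. if a' xs - a xs = 0 then d xs else b xs)"
    by (intro computable_if_zero computable_diff assms)
  moreover have "(\<lambda>xs. if a' xs - a xs = 0 then d xs else b xs)
      = (\<lambda>xs. if a xs < a' xs then b xs else d xs)"
    by auto
  ultimately show ?thesis by simp
qed

lemma computable_if_eq:
  assumes "computable n a" "computable n a'" "computable n b" "computable n d"
  shows "computable n (\<lambda>xs. if a xs = a' xs then b xs else d xs)"
proof -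
  have "computable n (\<lambda>xs. if (a' xs - a xs) + (a xs - a' xs) = 0 then b xs else d xs)"
    by (intro computable_if_zero computable_diff computable_add assms)
  moreover have "(\<lambda>xs. if (a' xs - a xs) + (a xs - a' xs) = 0 then b xs else d xs)
      = (\<lambda>xs. if a xs = a' xs then b xs else d xs)"
    by auto
  ultimately show ?thesis by simp
qed

section \<open>Cantor pairing and its inverses\<close>

abbreviation pair :: "nat \<Rightarrow> nat \<Rightarrow> nat" where "pair a b \<equiv> prod_encode (a, b)"
abbreviation pfst :: "nat \<Rightarrow> nat" where "pfst n \<equiv> fst (prod_decode n)"
abbreviation psnd :: "nat \<Rightarrow> nat" where "psnd n \<equiv> snd (prod_decode n)"

lemma computable_triangle:
  assumes "computable n a"
  shows "computable n (\<lambda>xs. triangle (a xs))"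
proof -
  have "computable 1 (\<lambda>xs. rec_nat 0 (\<lambda>k r. (k # r # xs) ! 1 + Suc ((k # r # xs) ! 0)) (xs ! 0))"
    by (rule computable_rec[where h = "\<lambda>ys. ys ! 1 + Suc (ys ! 0)" and b = "\<lambda>_. 0"])
      (intro computable_nth computable_const computable_add computable_Suc; simp)+
  moreover have "rec_nat 0 (\<lambda>k r. r + Suc k) m = triangle m" for m by (induction m) auto
  ultimately show ?thesis by (intro computable_comp1[of triangle, OF _ assms]) simp
qed

lemma computable_pair:
  "computable n a \<Longrightarrow> computable n b \<Longrightarrow> computable n (\<lambda>xs. pair (a xs) (b xs))"
  unfolding prod_encode_def by (simp add: computable_add computable_triangle)

lemma triangle_mono: "m \<le> n \<Longrightarrow> triangle m \<le> triangle n"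
  unfolding triangle_def by (intro div_le_mono mult_le_mono) auto

lemma pair_mono: "a \<le> a' \<Longrightarrow> b \<le> b' \<Longrightarrow> pair a b \<le> pair a' b'"
  unfolding prod_encode_def using triangle_mono[of "a + b" "a' + b'"] by simp

text \<open>The triangle number of \<open>a + b\<close> is at least \<open>a + b\<close>. This
  supports both the induction on codes and the bound on how far a formula looks.\<close>

lemma pair_ge: "a + b \<le> pair a b"
  by (cases "a + b") (auto simp: prod_encode_def)

text \<open>The codes of pairs with sum \<open>k\<close> fill the interval from
  \<open>triangle k\<close> up to, but excluding, \<open>triangle (Suc k)\<close>. The sum is
  therefore found by minimization, and both components follow from it by subtraction.\<close>

lemma computable_pair_sum: "computable 1 (\<lambda>xs. pfst (xs ! 0) + psnd (xs ! 0))"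
proof -
  have *: "(LEAST k. (if a < triangle (Suc k) then 0 else 1) = (0 :: nat)) = pfst a + psnd a" for a
  proof (rule Least_equality)
    obtain u v where a: "a = pair u v" by (metis prod_decode_inverse surj_pair)
    show "(if a < triangle (Suc (pfst a + psnd a)) then 0 else 1) = (0 :: nat)"
      by (simp add: a) (simp add: prod_encode_def)
    fix k assume "(if a < triangle (Suc k) then 0 else 1) = (0 :: nat)"
    then have "a < triangle (Suc k)" by (auto split: if_splits)
    then have "triangle (u + v) < triangle (Suc k)" by (simp add: a prod_encode_def)
    then have "\<not> Suc k \<le> u + v" using triangle_mono[of "Suc k" "u + v"] by linarith
    then show "pfst a + psnd a \<le> k" by (simp add: a)
  qed
  let ?f = "\<lambda>ys. if ys ! 1 < triangle (Suc (ys ! 0)) then 0 else (1 :: nat)"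
  have "computable 1 (\<lambda>xs. LEAST k. ?f (k # xs) = 0)"
  proof (rule computable_least[of 1 ?f])
    show "computable (Suc 1) (\<lambda>ys. if ys ! 1 < triangle (Suc (ys ! 0)) then 0 else 1)"
      by (intro computable_if_less computable_triangle computable_nth computable_Suc computable_const)
        auto
    fix xs :: "nat list"
    show "\<exists>k. (if (k # xs) ! 1 < triangle (Suc ((k # xs) ! 0)) then 0 else 1) = (0 :: nat)"
      by (rule exI[of _ "xs ! 0"]) simp
  qed
  then show ?thesis by (simp add: * del: triangle_Suc if_True if_False split del: if_split)
qed

lemma computable_pfst:
  assumes "computable n a" shows "computable n (\<lambda>xs. pfst (a xs))"
proof -
  have "k - triangle (pfst k + psnd k) = pfst k" for k
  proof -
    have "pair (pfst k) (psnd k) = k" by simp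
    then have "triangle (pfst k + psnd k) + pfst k = k" by (simp only: prod_encode_def split_conv)
    then show ?thesis by linarith
  qed
  then show ?thesis
    using computable_diff[OF assms computable_triangle[OF computable_comp1[OF computable_pair_sum assms]]]
    by simp
qed

lemma computable_psnd:
  assumes "computable n a" shows "computable n (\<lambda>xs. psnd (a xs))"
  using computable_diff[OF computable_comp1[OF computable_pair_sum assms] computable_pfst[OF assms]]
  by simp

lemmas computable_intros = computable_nth computable_const computable_Suc computable_add
  computable_diff computable_pair computable_pfst computable_psnd computable_if_eq
  computable_if_less


section \<open>Streams, integers and positions as numbers\<close>

text \<open>Every number is an infinite stream of numbers that is eventually 0.\<close>

definition snth :: "nat \<Rightarrow> nat \<Rightarrow> nat" where
  "snth t m = pfst ((psnd ^^ t) m)"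

lemma snth_0 [simp]: "snth 0 m = pfst m"
  and snth_Suc [simp]: "snth (Suc t) m = snth t (psnd m)"
  by (simp_all add: snth_def funpow_Suc_right del: funpow.simps)

lemma computable_snth:
  assumes "computable n a" "computable n b"
  shows "computable n (\<lambda>xs. snth (a xs) (b xs))"
  unfolding snth_def
  by (intro computable_pfst computable_funpow1 computable_psnd computable_nth assms) simp

primrec stream_code :: "nat list \<Rightarrow> nat" where
  "stream_code [] = 0"
| "stream_code (x # xs) = pair x (stream_code xs)"

lemma snth_stream_code: "t < length xs \<Longrightarrow> snth t (stream_code xs) = xs ! t"
  by (induction xs arbitrary: t) (auto simp: less_Suc_eq_0_disj)

text \<open>The code of the list of \<open>n\<close> copies of \<open>L\<close>. As pairing is
  monotone, it is the largest code of a list of length \<open>n\<close> with entries at most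
  \<open>L\<close>.\<close>

definition stream_bound :: "nat \<Rightarrow> nat \<Rightarrow> nat" where
  "stream_bound L n = (pair L ^^ n) 0"

lemma stream_code_le: "\<forall>x \<in> set xs. x \<le> L \<Longrightarrow> stream_code xs \<le> stream_bound L (length xs)"
  by (induction xs) (auto simp: stream_bound_def intro: pair_mono)

lemma computable_stream_bound:
  assumes "computable n a" "computable n b"
  shows "computable n (\<lambda>xs. stream_bound (a xs) (b xs))"
  unfolding stream_bound_def
  by (intro computable_funpow[of pair] computable_intros assms) simp_all

section \<open>Integers, positions and moves on codes\<close>

lemma int_encode_if: "int_encode i = (if 0 \<le> i then 2 * nat i else Suc (2 * nat (- i - 1)))"
  by (simp add: int_encode_def sum_encode_def)

lemma int_encode_le: "\<bar>i\<bar> \<le> int k \<Longrightarrow> int_encode i \<le> k + k"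
  by (auto simp: int_encode_if)

text \<open>Even codes are the nonnegative integers, odd codes the negative ones. At -1, coded by 1,
  truncated subtraction gives 0, which is the correct code.\<close>

definition code_inc :: "nat \<Rightarrow> nat" where
  "code_inc n = (if n mod 2 = 0 then n + 2 else n - 2)"

text \<open>Passing from 0 to -1 changes the parity of the code, hence the separate first
  case.\<close>

definition code_dec :: "nat \<Rightarrow> nat" where
  "code_dec n = (if n = 0 then 1 else if n mod 2 = 0 then n - 2 else n + 2)"

lemma code_inc: "code_inc (int_encode i) = int_encode (i + 1)"
proof (cases "0 \<le> i")
  case True
  then show ?thesis by (auto simp: code_inc_def int_encode_if nat_add_distrib)
next
  case False
  define k where "k = nat (- i - 1)"
  then have "i = - int k - 1" using False by simp
  then show ?thesis
    by (cases k) (auto simp: code_inc_def int_encode_if mod_Suc nat_eq_iff)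
qed

lemma code_dec: "code_dec (int_encode i) = int_encode (i - 1)"
proof (cases "0 \<le> i")
  case True
  define k where "k = nat i"
  then have "i = int k" using True by simp
  then show ?thesis by (cases k) (auto simp: code_dec_def int_encode_if nat_eq_iff)
next
  case False
  define k where "k = nat (- i - 1)"
  then have "i = - int k - 1" using False by simp
  then show ?thesis
    by (cases k) (auto simp: code_dec_def int_encode_if mod_Suc nat_eq_iff)
qed

lemma computable_mod2:
  assumes "computable n a"
  shows "computable n (\<lambda>xs. a xs mod 2)"
proof -
  have "((\<lambda>r. 1 - r) ^^ k) 0 = k mod 2" for k :: nat
    by (induction k) (auto simp: mod_Suc)
  moreover have "computable n (\<lambda>xs. ((\<lambda>r. 1 - r) ^^ a xs) 0)"
    by (intro computable_funpow1 computable_intros assms) simp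
  ultimately show ?thesis by simp
qed

lemma computable_code_inc: "computable n a \<Longrightarrow> computable n (\<lambda>xs. code_inc (a xs))"
  unfolding code_inc_def by (intro computable_mod2 computable_intros)

lemma computable_code_dec: "computable n a \<Longrightarrow> computable n (\<lambda>xs. code_dec (a xs))"
  unfolding code_dec_def by (intro computable_mod2 computable_intros)

definition pos_code :: "pos \<Rightarrow> nat" where
  "pos_code w = pair (int_encode (fst w)) (int_encode (snd w))"

lemma pos_code_eq [simp]: "pos_code v = pos_code w \<longleftrightarrow> v = w"
  by (auto simp: pos_code_def int_encode_eq prod_eq_iff)

text \<open>Every number codes a position, so every stream places all agents: each candidate met by
  the search is a model.\<close>

lemma surj_pos_code: "surj pos_code"
  by (rule surjI[of _ "\<lambda>n. (int_decode (pfst n), int_decode (psnd n))"]) (simp add: pos_code_def)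

lemma pos_code_le:
  "\<bar>fst w\<bar> \<le> int k \<Longrightarrow> \<bar>snd w\<bar> \<le> int k \<Longrightarrow> pos_code w \<le> pair (k + k) (k + k)"
  unfolding pos_code_def by (intro pair_mono int_encode_le)

definition code_move :: "nat \<Rightarrow> nat \<Rightarrow> nat" where
  "code_move a p =
    (if a = 0 then pair (pfst p) (code_inc (psnd p))
     else if a = 1 then pair (pfst p) (code_dec (psnd p))
     else if a = 2 then pair (code_dec (pfst p)) (psnd p)
     else if a = 3 then pair (code_inc (pfst p)) (psnd p)
     else p)"

lemma code_move: "code_move (act_code a) (pos_code w) = pos_code (move a w)"
  by (cases a; cases w) (auto simp: code_move_def pos_code_def code_inc code_dec)

lemma computable_code_move:
  "computable n a \<Longrightarrow> computable n b \<Longrightarrow> computable n (\<lambda>xs. code_move (a xs) (b xs))"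
  unfolding code_move_def by (intro computable_code_inc computable_code_dec computable_intros)

text \<open>\<open>list_encode\<close> adds one to the pair of head and tail, hence
  \<open>d - 1\<close>. The recursion is over the fixed number of agents, so for each
  \<open>n\<close> this is a finite composition of computable functions.\<close>

primrec joint_move :: "nat \<Rightarrow> nat \<Rightarrow> nat \<Rightarrow> nat" where
  "joint_move 0 d s = 0"
| "joint_move (Suc n) d s =
    pair (code_move (pfst (d - 1)) (pfst s)) (joint_move n (psnd (d - 1)) (psnd s))"

lemma joint_move:
  "j < length as \<Longrightarrow>
    snth j (joint_move (length as) (list_encode as) s) = code_move (as ! j) (snth j s)"
  by (induction as arbitrary: s j) (auto simp: less_Suc_eq_0_disj)

lemma computable_joint_move:
  "computable n a \<Longrightarrow> computable n b \<Longrightarrow> computable n (\<lambda>xs. joint_move k (a xs) (b xs))"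
proof (induction k arbitrary: a b)
  case 0
  then show ?case by (simp add: computable_const)
next
  case (Suc k)
  then show ?case
    by (simp only: joint_move.simps) (intro computable_pair computable_code_move Suc.IH computable_intros)
qed


section \<open>An abstract machine for model checking\<close>

text \<open>A configuration is a verdict (0 or 1) or a formula to be evaluated at a position under an
  assignment of positions to agents, together with the configurations to continue with if it is
  true and if it is false. Boxes over composite programs are rewritten on the level of codes.\<close>

definition cont :: "nat \<Rightarrow> nat \<Rightarrow> nat \<Rightarrow> nat \<Rightarrow> nat \<Rightarrow> nat" where
  "cont x w s kt kf = pair x (pair w (pair s (pair kt kf))) + 2"

definition cneg :: "nat \<Rightarrow> nat" where
  "cneg x = pair 2 x"

definition cconj :: "nat \<Rightarrow> nat \<Rightarrow> nat" where
  "cconj x y = pair 3 (pair x y)"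

text \<open>The tag \<open>t\<close> is 4 for spatial and 5 for motion boxes. Both kinds share their
  rewriting rules, since composite programs carry the same tags in both codings.\<close>

definition cbox :: "nat \<Rightarrow> nat \<Rightarrow> nat \<Rightarrow> nat" where
  "cbox t a x = pair t (pair a x)"

text \<open>The codes of the spatial moves and of the actions list right and left in opposite orders.\<close>

definition box_step :: "nat \<Rightarrow> nat \<Rightarrow> nat \<Rightarrow> nat \<Rightarrow> nat \<Rightarrow> nat \<Rightarrow> nat \<Rightarrow> nat \<Rightarrow> nat" where
  "box_step n t a x w s kt kf =
    (let b = psnd a in
     if pfst a = 0 then
       if t = 4 then cont x (code_move (if b = 2 then 3 else if b = 3 then 2 else b) w) s kt kf
       else cont x w (joint_move n b s) kt kf
     else if pfst a = 1 then cont (cbox t (pfst b) (cbox t (psnd b) x)) w s kt kf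
     else if pfst a = 2 then cont (cconj (cbox t (pfst b) x) (cbox t (psnd b) x)) w s kt kf
     else cont (cneg (cconj b (cneg x))) w s kt kf)"

text \<open>The stream \<open>m\<close> gives the valuation, \<open>s\<close> the positions of the
  agents. Negation swaps the continuations; conjunction puts its second conjunct into the success
  continuation of the first. All tags from 4 on count as boxes, so junk is processed too.\<close>

definition fm_step :: "nat \<Rightarrow> nat \<Rightarrow> nat \<Rightarrow> nat \<Rightarrow> nat \<Rightarrow> nat \<Rightarrow> nat \<Rightarrow> nat" where
  "fm_step n m x w s kt kf =
    (let t = pfst x; y = psnd x in
     if t = 0 then if snth (pair w y) m = 1 then kt else kf
     else if t = 1 then if snth y s = w then kt else kf
     else if t = 2 then cont y w s kf kt
     else if t = 3 then cont (pfst y) w s (cont (psnd y) w s kt kf) kf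
     else box_step n t (pfst y) (psnd y) w s kt kf)"

text \<open>As \<open>cont\<close> adds 2, the numbers 0 and 1 are free for the verdicts; these are
  fixed points, and any other number is decoded as a configuration.\<close>

definition step :: "nat \<Rightarrow> nat \<Rightarrow> nat \<Rightarrow> nat" where
  "step n m K =
    (if K < 2 then K
     else let z = K - 2; z2 = psnd z; z3 = psnd z2; z4 = psnd z3
       in fm_step n m (pfst z) (pfst z2) (pfst z3) (pfst z4) (psnd z4))"

lemma step_cont: "step n m (cont x w s kt kf) = fm_step n m x w s kt kf"
  by (simp add: step_def cont_def)

lemma step_halt: "K < 2 \<Longrightarrow> step n m K = K"
  by (simp add: step_def)

lemma computable_step:
  assumes "computable k a" "computable k b"
  shows "computable k (\<lambda>xs. step n (a xs) (b xs))"
  unfolding step_def fm_step_def box_step_def cont_def cneg_def cconj_def cbox_def Let_def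
  by (intro computable_snth computable_code_move computable_joint_move computable_intros assms)

section \<open>Halting on all codes\<close>

definition reach :: "nat \<Rightarrow> nat \<Rightarrow> nat \<Rightarrow> nat \<Rightarrow> bool" where
  "reach n m K K' \<longleftrightarrow> (\<exists>k. (step n m ^^ k) K = K')"

lemma reach_refl: "reach n m K K"
  unfolding reach_def by (rule exI[of _ 0]) simp

lemma reach_trans: "reach n m K K' \<Longrightarrow> reach n m K' K'' \<Longrightarrow> reach n m K K''"
  unfolding reach_def by (metis funpow_add comp_apply)

lemma reach_cont:
  assumes "reach n m (fm_step n m x w s kt kf) K"
  shows "reach n m (cont x w s kt kf) K"
proof -
  from assms obtain k where "(step n m ^^ k) (step n m (cont x w s kt kf)) = K"
    by (auto simp: reach_def step_cont)
  then have "(step n m ^^ Suc k) (cont x w s kt kf) = K" by (simp add: funpow_swap1)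
  then show ?thesis unfolding reach_def by blast
qed

text \<open>Ranging over all continuations makes the notion compose under negation and conjunction;
  ranging over all \<open>w\<close> and \<open>s\<close> absorbs the effect of moves.\<close>

definition halts :: "nat \<Rightarrow> nat \<Rightarrow> nat \<Rightarrow> bool" where
  "halts n m x \<longleftrightarrow>
    (\<forall>w s kt kf. reach n m (cont x w s kt kf) kt \<or> reach n m (cont x w s kt kf) kf)"

lemma haltsD: "halts n m x \<Longrightarrow> \<exists>K \<in> {kt, kf}. reach n m (cont x w s kt kf) K"
  by (auto simp: halts_def)

lemma halts_cneg:
  assumes "halts n m x" shows "halts n m (cneg x)"
proof -
  have "reach n m (cont (cneg x) w s kt kf) K" if "reach n m (cont x w s kf kt) K" for w s kt kf K
    using that by (intro reach_cont) (simp add: cneg_def fm_step_def)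
  then show ?thesis using assms unfolding halts_def by blast
qed

lemma halts_cconj:
  assumes "halts n m x" "halts n m y" shows "halts n m (cconj x y)"
  unfolding halts_def
proof (intro allI)
  fix w s kt kf
  let ?k = "cont y w s kt kf"
  have "fm_step n m (cconj x y) w s kt kf = cont x w s ?k kf"
    by (simp add: fm_step_def cconj_def)
  moreover have "\<exists>K \<in> {kt, kf}. reach n m (cont x w s ?k kf) K"
    using haltsD[OF assms(1), of ?k kf w s] haltsD[OF assms(2), of kt kf w s]
    by (auto intro: reach_trans)
  ultimately show "reach n m (cont (cconj x y) w s kt kf) kt
      \<or> reach n m (cont (cconj x y) w s kt kf) kf"
    by (auto intro: reach_cont)
qed

text \<open>The machine has to halt on junk codes as well: its running time is obtained by minimization
  of a function that must be regular.\<close>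

lemma halts_all: "halts n m x \<and> (\<forall>t \<ge> 4. \<forall>y. halts n m y \<longrightarrow> halts n m (cbox t x y))"
\<comment> \<open>Each code is treated both as a formula and as a program. Rewriting enlarges the
  box body but breaks the program into smaller codes, so the second conjunct admits any halting
  body.\<close>
proof (induction x rule: less_induct)
  case (less x)
  define t y where "t = pfst x" and "y = psnd x"
  have x: "x = pair t y" by (simp add: t_def y_def)
  \<comment> \<open>Tag 0 is excluded because \<open>pair 0 0\<close> is 0, whose components are not
    smaller.\<close>
  have lt: "y < x" "pfst y < x" "psnd y < x" if "t > 0"
  proof -
    show "y < x" using that pair_ge[of t y] by (simp add: x)
    moreover have "pfst y + psnd y \<le> y" using pair_ge[of "pfst y" "psnd y"] by simp
    ultimately show "pfst y < x" "psnd y < x" by simp_all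
  qed
  have "halts n m x"
  proof -
    consider "t = 0" | "t = 1" | "t = 2" | "t = 3" | "t \<ge> 4" by linarith
    then show ?thesis
    proof cases
      case 1
      then show ?thesis unfolding halts_def
        by (auto simp: x fm_step_def intro!: reach_cont reach_refl)
    next
      case 2
      then show ?thesis unfolding halts_def
        by (auto simp: x fm_step_def intro!: reach_cont reach_refl)
    next
      case 3
      then show ?thesis using halts_cneg[of n m y] less lt by (simp add: x cneg_def)
    next
      case 4
      then show ?thesis using halts_cconj[of n m "pfst y" "psnd y"] less lt
        by (simp add: x cconj_def)
    next
      case 5
      then have "halts n m (cbox t (pfst y) (psnd y))" using less lt by simp
      then show ?thesis by (simp add: x cbox_def)
    qed
  qed
  moreover have "halts n m (cbox u x z)" if u: "u \<ge> 4" and z: "halts n m z" for u z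
  proof -
    have fm: "fm_step n m (cbox u x z) w s kt kf = box_step n u x z w s kt kf" for w s kt kf
      using u by (simp add: fm_step_def cbox_def)
    have rewrite: ?thesis
      if "\<And>w s kt kf. box_step n u x z w s kt kf = cont z' w s kt kf" "halts n m z'" for z'
      using that haltsD[OF that(2)] unfolding halts_def by (metis fm reach_cont)
    consider "t = 0" | "t = 1" | "t = 2" | "t \<ge> 3" by linarith
    then show ?thesis
    proof cases
      case 1
      have "\<exists>w' s'. box_step n u x z w s kt kf = cont z w' s' kt kf" for w s kt kf
        using 1 by (auto simp: box_step_def x)
      then show ?thesis using z unfolding halts_def by (metis fm reach_cont)
    next
      case 2
      then show ?thesis
        by (intro rewrite[of "cbox u (pfst y) (cbox u (psnd y) z)"])
          (use less lt u z in \<open>auto simp: box_step_def x\<close>)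
    next
      case 3
      then show ?thesis
        by (intro rewrite[of "cconj (cbox u (pfst y) z) (cbox u (psnd y) z)"] halts_cconj)
          (use less lt u z in \<open>auto simp: box_step_def x\<close>)
    next
      case 4
      then show ?thesis
        by (intro rewrite[of "cneg (cconj y (cneg z))"] halts_cconj halts_cneg)
          (use less lt z in \<open>auto simp: box_step_def x\<close>)
    qed
  qed
  ultimately show ?case by blast
qed


locale coding =
  fixes c :: "'atm \<Rightarrow> nat" and ags :: "'agt list"
  assumes inj_c: "inj c" and agents: "set ags = UNIV"
begin

lemma agent_code_less: "agent_code ags i < length ags"
  and nth_agent_code [simp]: "ags ! agent_code ags i = i"
proof -
  have "length (takeWhile (\<lambda>j. j \<noteq> i) xs) < length xs \<and> xs ! length (takeWhile (\<lambda>j. j \<noteq> i) xs) = i"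
    if "i \<in> set xs" for xs
    using that by (induction xs) auto
  then show "agent_code ags i < length ags" "ags ! agent_code ags i = i"
    using agents by (simp_all add: agent_code_def)
qed

section \<open>Correctness of the machine\<close>

definition stream_val :: "nat \<Rightarrow> pos \<Rightarrow> 'atm set" where
  "stream_val m w = {p. snth (pair (pos_code w) (c p)) m = 1}"

definition represents :: "nat \<Rightarrow> ('agt \<Rightarrow> pos) \<Rightarrow> bool" where
  "represents s P \<longleftrightarrow> (\<forall>i. snth (agent_code ags i) s = pos_code (P i))"

text \<open>Stated for a semantic predicate \<open>Q\<close>, so that a box can be treated over any
  body already decided. The valuation is fixed by \<open>m\<close>, while the placement
  \<open>P\<close> varies because joint actions change it.\<close>

definition decides :: "nat \<Rightarrow> nat \<Rightarrow> (('atm, 'agt) model \<Rightarrow> pos \<Rightarrow> bool) \<Rightarrow> bool" where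
  "decides m x Q \<longleftrightarrow> (\<forall>P s w kt kf. represents s P \<longrightarrow>
    reach (length ags) m (cont x (pos_code w) s kt kf)
      (if Q (P, stream_val m) w then kt else kf))"

lemma decidesI:
  assumes "\<And>P s w kt kf. represents s P \<Longrightarrow>
    reach (length ags) m (fm_step (length ags) m x (pos_code w) s kt kf)
      (if Q (P, stream_val m) w then kt else kf)"
  shows "decides m x Q"
  using assms unfolding decides_def by (blast intro: reach_cont)

lemma decidesD:
  "decides m x Q \<Longrightarrow> represents s P \<Longrightarrow>
    reach (length ags) m (cont x (pos_code w) s kt kf)
      (if Q (P, stream_val m) w then kt else kf)"
  unfolding decides_def by blast

lemma decides_cneg:
  assumes "decides m x Q"
  shows "decides m (cneg x) (\<lambda>M w. \<not> Q M w)"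
proof (rule decidesI)
  fix P s w kt kf assume "represents s P"
  from decidesD[OF assms this, of w kf kt]
  show "reach (length ags) m (fm_step (length ags) m (cneg x) (pos_code w) s kt kf)
      (if \<not> Q (P, stream_val m) w then kt else kf)"
    by (simp add: fm_step_def cneg_def split: if_splits)
qed

lemma decides_cconj:
  assumes "decides m x Q" "decides m y R"
  shows "decides m (cconj x y) (\<lambda>M w. Q M w \<and> R M w)"
proof (rule decidesI)
  fix P s w kt kf assume s: "represents s P"
  let ?k = "cont y (pos_code w) s kt kf"
  from decidesD[OF assms(1) s, of w ?k kf] decidesD[OF assms(2) s, of w kt kf]
  have "reach (length ags) m (cont x (pos_code w) s ?k kf)
      (if Q (P, stream_val m) w \<and> R (P, stream_val m) w then kt else kf)"
    by (auto intro: reach_trans split: if_splits)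
  then show "reach (length ags) m (fm_step (length ags) m (cconj x y) (pos_code w) s kt kf)
      (if Q (P, stream_val m) w \<and> R (P, stream_val m) w then kt else kf)"
    by (simp add: fm_step_def cconj_def)
qed

lemma decides_cbox_rewrite:
  assumes "decides m z Q" "t \<ge> 4"
    and "\<And>w s kt kf. box_step (length ags) t a x w s kt kf = cont z w s kt kf"
  shows "decides m (cbox t a x) Q"
proof (rule decidesI)
  fix P s w kt kf assume "represents s P"
  from decidesD[OF assms(1) this]
  show "reach (length ags) m (fm_step (length ags) m (cbox t a x) (pos_code w) s kt kf)
      (if Q (P, stream_val m) w then kt else kf)"
    using assms(2,3) by (simp add: fm_step_def cbox_def)
qed

lemma decides_cbox_seq:
  "t \<ge> 4 \<Longrightarrow> decides m (cbox t a (cbox t b x)) Q \<Longrightarrow> decides m (cbox t (pair 1 (pair a b)) x) Q"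
  by (erule decides_cbox_rewrite) (simp_all add: box_step_def)

lemma decides_cbox_choice:
  "t \<ge> 4 \<Longrightarrow> decides m (cbox t a x) Q \<Longrightarrow> decides m (cbox t b x) R \<Longrightarrow>
    decides m (cbox t (pair 2 (pair a b)) x) (\<lambda>M w. Q M w \<and> R M w)"
  by (rule decides_cbox_rewrite[OF decides_cconj]) (simp_all add: box_step_def)

lemma decides_cbox_test:
  "t \<ge> 4 \<Longrightarrow> decides m y R \<Longrightarrow> decides m x Q \<Longrightarrow>
    decides m (cbox t (pair 3 y) x) (\<lambda>M w. \<not> (R M w \<and> \<not> Q M w))"
  by (rule decides_cbox_rewrite[OF decides_cneg[OF decides_cconj[OF _ decides_cneg]]])
    (simp_all add: box_step_def)

text \<open>The hypothesis on \<open>b\<close> converts the code of a spatial move into that of the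
  corresponding action, exchanging left and right.\<close>

lemma decides_cbox_move:
  assumes x: "decides m x Q"
    and b: "act_code a = (if b = 2 then 3 else if b = 3 then 2 else b)"
  shows "decides m (cbox 4 (pair 0 b) x) (\<lambda>M w. Q M (move a w))"
proof (rule decidesI)
  fix P s w kt kf assume "represents s P"
  from decidesD[OF x this]
  show "reach (length ags) m (fm_step (length ags) m (cbox 4 (pair 0 b) x) (pos_code w) s kt kf)
      (if Q (P, stream_val m) (move a w) then kt else kf)"
    by (simp add: fm_step_def cbox_def box_step_def code_move b[symmetric])
qed

definition joint :: "('agt \<Rightarrow> act) \<Rightarrow> ('atm, 'agt) model \<Rightarrow> ('atm, 'agt) model" where
  "joint \<delta> M = (\<lambda>i. move (\<delta> i) (fst M i), snd M)"

lemma mrel_Joint_iff: "(M, M') \<in> mrel (Joint \<delta>) w \<longleftrightarrow> M' = joint \<delta> M"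
  by (cases M; cases M') (auto simp: joint_def)

lemma decides_cbox_joint:
  assumes x: "decides m x Q"
  shows "decides m (cbox 5 (pair 0 (joint_code ags \<delta>)) x) (\<lambda>M w. Q (joint \<delta> M) w)"
proof (rule decidesI)
  fix P s w kt kf assume s: "represents s P"
  let ?s = "joint_move (length ags) (joint_code ags \<delta>) s"
  have "represents ?s (\<lambda>i. move (\<delta> i) (P i))"
    unfolding represents_def
  proof
    fix i
    show "snth (agent_code ags i) ?s = pos_code (move (\<delta> i) (P i))"
      using joint_move[of "agent_code ags i" "map (\<lambda>i. act_code (\<delta> i)) ags" s]
        agent_code_less[of i] s
      by (simp add: joint_code_def represents_def code_move)
  qed
  from decidesD[OF x this]
  show "reach (length ags) m
      (fm_step (length ags) m (cbox 5 (pair 0 (joint_code ags \<delta>)) x) (pos_code w) s kt kf)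
      (if Q (joint \<delta> (P, stream_val m)) w then kt else kf)"
    by (simp add: fm_step_def cbox_def box_step_def joint_def)
qed

lemma srel_moves:
  "(w, w') \<in> srel SUp M \<longleftrightarrow> w' = move MUp w"
  "(w, w') \<in> srel SDown M \<longleftrightarrow> w' = move MDown w"
  "(w, w') \<in> srel SRight M \<longleftrightarrow> w' = move MRight w"
  "(w, w') \<in> srel SLeft M \<longleftrightarrow> w' = move MLeft w"
  by (cases w; cases w'; auto)+

text \<open>Boxes as transformers of arbitrary predicates. The equations below mirror semantically
  what \<open>box_step\<close> does on codes.\<close>

abbreviation sbox_sem where
  "sbox_sem \<alpha> Q \<equiv> \<lambda>M w. \<forall>w'. (w, w') \<in> srel \<alpha> M \<longrightarrow> Q M w'"

abbreviation mbox_sem where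
  "mbox_sem \<beta> Q \<equiv> \<lambda>M w. \<forall>M'. (M, M') \<in> mrel \<beta> w \<longrightarrow> Q M' w"

lemma sbox_sem_simps:
  "sbox_sem SUp Q = (\<lambda>M w. Q M (move MUp w))"
  "sbox_sem SDown Q = (\<lambda>M w. Q M (move MDown w))"
  "sbox_sem SRight Q = (\<lambda>M w. Q M (move MRight w))"
  "sbox_sem SLeft Q = (\<lambda>M w. Q M (move MLeft w))"
  "sbox_sem (SSeq \<alpha>1 \<alpha>2) Q = sbox_sem \<alpha>1 (sbox_sem \<alpha>2 Q)"
  "sbox_sem (SChoice \<alpha>1 \<alpha>2) Q = (\<lambda>M w. sbox_sem \<alpha>1 Q M w \<and> sbox_sem \<alpha>2 Q M w)"
  "sbox_sem (STest \<phi>) Q = (\<lambda>M w. \<not> (sat \<phi> M w \<and> \<not> Q M w))"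
  unfolding srel_moves by (auto intro!: ext)

lemma mbox_sem_simps:
  "mbox_sem (Joint \<delta>) Q = (\<lambda>M w. Q (joint \<delta> M) w)"
  "mbox_sem (MSeq \<beta>1 \<beta>2) Q = mbox_sem \<beta>1 (mbox_sem \<beta>2 Q)"
  "mbox_sem (MChoice \<beta>1 \<beta>2) Q = (\<lambda>M w. mbox_sem \<beta>1 Q M w \<and> mbox_sem \<beta>2 Q M w)"
  "mbox_sem (MTest \<phi>) Q = (\<lambda>M w. \<not> (sat \<phi> M w \<and> \<not> Q M w))"
  unfolding mrel_Joint_iff by (auto intro!: ext)

lemma sat_box:
  "sat (SBox \<alpha> \<phi>) = sbox_sem \<alpha> (sat \<phi>)"
  "sat (MBox \<beta> \<phi>) = mbox_sem \<beta> (sat \<phi>)"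
  "sat (Neg \<phi>) = (\<lambda>M w. \<not> sat \<phi> M w)"
  "sat (Conj \<phi> \<psi>) = (\<lambda>M w. sat \<phi> M w \<and> sat \<psi> M w)"
  by (auto intro!: ext)

text \<open>The claims on programs hold for every decided body, so in the case of a sequence the
  hypothesis for the first program applies to a body that is itself a box.\<close>

lemma decides_sat: "decides m (fm_code c ags \<phi>) (sat \<phi>)"
  and decides_sbox:
    "decides m x Q \<Longrightarrow> decides m (cbox 4 (sprog_code c ags \<alpha>) x) (sbox_sem \<alpha> Q)"
  and decides_mbox:
    "decides m x Q \<Longrightarrow> decides m (cbox 5 (mprog_code c ags \<beta>) x) (mbox_sem \<beta> Q)"
proof (induction \<phi> and \<alpha> and \<beta> arbitrary: and x Q and x Q)
  case (Atom p)
  show ?case by (rule decidesI) (auto simp: fm_step_def stream_val_def intro: reach_refl)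
next
  case (Here i)
  show ?case by (rule decidesI) (auto simp: fm_step_def represents_def intro: reach_refl)
next
  case (Neg \<phi>)
  from decides_cneg[OF this] show ?case by (simp add: cneg_def sat_box(3))
next
  case (Conj \<phi> \<psi>)
  from decides_cconj[OF this] show ?case by (simp add: cconj_def sat_box(4))
next
  case (SBox \<alpha> \<phi>)
  from SBox(1)[OF SBox(2)] show ?case unfolding sat_box by (simp add: cbox_def)
next
  case (MBox \<beta> \<phi>)
  from MBox(1)[OF MBox(2)] show ?case unfolding sat_box by (simp add: cbox_def)
next
  case SUp
  then show ?case unfolding sbox_sem_simps by (simp add: decides_cbox_move)
next
  case SDown
  then show ?case unfolding sbox_sem_simps by (simp add: decides_cbox_move)
next
  case SRight
  then show ?case unfolding sbox_sem_simps by (simp add: decides_cbox_move)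
next
  case SLeft
  then show ?case unfolding sbox_sem_simps by (simp add: decides_cbox_move)
next
  case (SSeq \<alpha>1 \<alpha>2)
  from SSeq(1)[OF SSeq(2)[OF SSeq(3)]] show ?case
    unfolding sbox_sem_simps by (simp add: decides_cbox_seq del: One_nat_def)
next
  case (SChoice \<alpha>1 \<alpha>2)
  from SChoice(1)[OF SChoice(3)] SChoice(2)[OF SChoice(3)] show ?case
    unfolding sbox_sem_simps by (simp add: decides_cbox_choice)
next
  case (STest \<phi>)
  then show ?case unfolding sbox_sem_simps sprog_code.simps by (intro decides_cbox_test) simp_all
next
  case (Joint \<delta>)
  then show ?case unfolding mbox_sem_simps by (simp add: decides_cbox_joint)
next
  case (MSeq \<beta>1 \<beta>2)
  from MSeq(1)[OF MSeq(2)[OF MSeq(3)]] show ?case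
    unfolding mbox_sem_simps by (simp add: decides_cbox_seq del: One_nat_def)
next
  case (MChoice \<beta>1 \<beta>2)
  from MChoice(1)[OF MChoice(3)] MChoice(2)[OF MChoice(3)] show ?case
    unfolding mbox_sem_simps by (simp add: decides_cbox_choice)
next
  case (MTest \<phi>)
  then show ?case unfolding mbox_sem_simps mprog_code.simps by (intro decides_cbox_test) simp_all
qed


subsection \<open>Locality\<close>

definition offset :: "pos \<Rightarrow> pos \<Rightarrow> pos" where
  "offset w v = (fst v - fst w, snd v - snd w)"

definition near :: "nat \<Rightarrow> pos \<Rightarrow> bool" where
  "near r v \<longleftrightarrow> \<bar>fst v\<bar> \<le> int r \<and> \<bar>snd v\<bar> \<le> int r"

text \<open>Agreement up to translation, for atoms with code at most \<open>N\<close>. Agents out of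
  range need only be out of range on both sides, which allows a small model to place them all at one
  spot.\<close>

definition similar :: "nat \<Rightarrow> nat \<Rightarrow> ('atm, 'agt) model \<Rightarrow> pos \<Rightarrow> ('atm, 'agt) model \<Rightarrow> pos \<Rightarrow> bool" where
  "similar N r M w M' w' \<longleftrightarrow>
    (\<forall>v v' p. offset w v = offset w' v' \<and> near r (offset w v) \<and> c p \<le> N \<longrightarrow>
      (p \<in> snd M v \<longleftrightarrow> p \<in> snd M' v')) \<and>
    (\<forall>i. offset w (fst M i) = offset w' (fst M' i) \<or>
      \<not> near r (offset w (fst M i)) \<and> \<not> near r (offset w' (fst M' i)))"

definition local :: "nat \<Rightarrow> nat \<Rightarrow> (('atm, 'agt) model \<Rightarrow> pos \<Rightarrow> bool) \<Rightarrow> bool" where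
  "local N r Q \<longleftrightarrow> (\<forall>M w M' w'. similar N r M w M' w' \<longrightarrow> Q M w = Q M' w')"

lemma offset_eq_zero: "offset w v = (0, 0) \<longleftrightarrow> v = w"
  by (auto simp: offset_def prod_eq_iff)

lemma near_zero: "near r (0, 0)"
  by (simp add: near_def)

lemma near_mono: "near r v \<Longrightarrow> r \<le> r' \<Longrightarrow> near r' v"
  by (auto simp: near_def)

lemma similar_mono: "similar N r' M w M' w' \<Longrightarrow> r \<le> r' \<Longrightarrow> similar N r M w M' w'"
  unfolding similar_def by (meson near_mono)

lemma local_mono: "local N r Q \<Longrightarrow> r \<le> r' \<Longrightarrow> local N r' Q"
  unfolding local_def by (blast intro: similar_mono)

lemma local_not: "local N r Q \<Longrightarrow> local N r (\<lambda>M w. \<not> Q M w)"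
  by (simp add: local_def)

lemma local_conj: "local N r Q \<Longrightarrow> local N r R \<Longrightarrow> local N r (\<lambda>M w. Q M w \<and> R M w)"
  unfolding local_def by blast

lemma offset_move:
  "offset (move a w) v = offset (move a w') v' \<longleftrightarrow> offset w v = offset w' v'"
  "near r (offset (move a w) v) \<Longrightarrow> near (Suc r) (offset w v)"
  "offset w (move a v) = offset w' (move a v') \<longleftrightarrow> offset w v = offset w' v'"
  "near r (offset w (move a v)) \<Longrightarrow> near (Suc r) (offset w v)"
  by (cases a; cases w; cases w'; cases v; cases v'; auto simp: offset_def near_def)+

lemma similar_move:
  "similar N (Suc r) M w M' w' \<Longrightarrow> similar N r M (move a w) M' (move a w')"
  unfolding similar_def offset_move(1) using offset_move(2) by meson

text \<open>Equal offsets stay equal under the same action, and an agent outside radius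
  \<open>Suc r\<close> is still outside radius \<open>r\<close> after one step.\<close>

lemma similar_joint:
  "similar N (Suc r) M w M' w' \<Longrightarrow> similar N r (joint \<delta> M) w (joint \<delta> M') w'"
  unfolding similar_def joint_def fst_conv snd_conv offset_move(3)
  using offset_move(4) near_mono[OF _ le_SucI[OF order_refl]] by meson

lemma local_move: "local N r Q \<Longrightarrow> local N (Suc r) (\<lambda>M w. Q M (move a w))"
  unfolding local_def by (blast intro: similar_move)

lemma local_joint: "local N r Q \<Longrightarrow> local N (Suc r) (\<lambda>M w. Q (joint \<delta> M) w)"
  unfolding local_def by (blast intro: similar_joint)

lemma pair_ge_args: "a \<le> pair a b" "b \<le> pair a b"
  using pair_ge[of a b] by auto

text \<open>The code of a formula bounds how far it looks. Codes of programs are off by one since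
  \<open>SUp\<close> has code 0.\<close>

lemma local_sat: "fm_code c ags \<phi> \<le> N \<Longrightarrow> local N (fm_code c ags \<phi>) (sat \<phi>)"
  and local_sbox: "sprog_code c ags \<alpha> \<le> N \<Longrightarrow> local N r Q \<Longrightarrow>
    local N (Suc (sprog_code c ags \<alpha>) + r) (sbox_sem \<alpha> Q)"
  and local_mbox: "mprog_code c ags \<beta> \<le> N \<Longrightarrow> local N r Q \<Longrightarrow>
    local N (Suc (mprog_code c ags \<beta>) + r) (mbox_sem \<beta> Q)"
proof (induction \<phi> and \<alpha> and \<beta> arbitrary: and r Q and r Q)
  case (Atom p)
  then have "c p \<le> N" using pair_ge[of 0 "c p"] by simp
  then show ?case by (auto simp: local_def similar_def offset_def near_def)
next
  case (Here i)
  have "fst M i = w \<longleftrightarrow> fst M' i = w'" if "similar N r M w M' w'"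
    for r and M M' :: "('atm, 'agt) model" and w w'
  proof -
    \<comment> \<open>Offset zero lies within every radius, so the out-of-range alternative of
      \<open>similar\<close> cannot apply.\<close>
    have "offset w (fst M i) = (0, 0) \<longleftrightarrow> offset w' (fst M' i) = (0, 0)"
      using that near_zero unfolding similar_def by metis
    then show ?thesis by (simp add: offset_eq_zero)
  qed
  then show ?case by (simp add: local_def)
next
  case (Neg \<phi>)
  have "fm_code c ags \<phi> \<le> fm_code c ags (Neg \<phi>)" by (simp add: pair_ge_args)
  with Neg show ?case unfolding sat_box(3) by (intro local_not) (auto intro: local_mono)
next
  case (Conj \<phi> \<psi>)
  have "fm_code c ags \<phi> \<le> fm_code c ags (Conj \<phi> \<psi>)" "fm_code c ags \<psi> \<le> fm_code c ags (Conj \<phi> \<psi>)"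
    using pair_ge_args le_trans by (simp_all, blast+)
  with Conj show ?case unfolding sat_box(4) by (intro local_conj) (auto intro: local_mono)
next
  case (SBox \<alpha> \<phi>)
  have "Suc (sprog_code c ags \<alpha>) + fm_code c ags \<phi> \<le> fm_code c ags (SBox \<alpha> \<phi>)"
    using pair_ge[of 4 "pair (sprog_code c ags \<alpha>) (fm_code c ags \<phi>)"]
      pair_ge[of "sprog_code c ags \<alpha>" "fm_code c ags \<phi>"] by simp
  with SBox show ?case unfolding sat_box(1) by (intro local_mono[OF SBox.IH(1)]) auto
next
  case (MBox \<beta> \<phi>)
  have "Suc (mprog_code c ags \<beta>) + fm_code c ags \<phi> \<le> fm_code c ags (MBox \<beta> \<phi>)"
    using pair_ge[of 5 "pair (mprog_code c ags \<beta>) (fm_code c ags \<phi>)"]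
      pair_ge[of "mprog_code c ags \<beta>" "fm_code c ags \<phi>"] by simp
  with MBox show ?case unfolding sat_box(2) by (intro local_mono[OF MBox.IH(1)]) auto
next
  case SUp
  then show ?case unfolding sbox_sem_simps by (intro local_mono[OF local_move]) auto
next
  case SDown
  then show ?case unfolding sbox_sem_simps by (intro local_mono[OF local_move]) auto
next
  case SRight
  then show ?case unfolding sbox_sem_simps by (intro local_mono[OF local_move]) auto
next
  case SLeft
  then show ?case unfolding sbox_sem_simps by (intro local_mono[OF local_move]) auto
next
  case (SSeq \<alpha>1 \<alpha>2)
  \<comment> \<open>Each component contributes a \<open>Suc\<close> to the radius; the tag 1 of the
    sequence pays for the second one.\<close>
  have "Suc (sprog_code c ags \<alpha>1 + sprog_code c ags \<alpha>2) \<le> sprog_code c ags (SSeq \<alpha>1 \<alpha>2)"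
    using pair_ge[of 1 "pair (sprog_code c ags \<alpha>1) (sprog_code c ags \<alpha>2)"]
      pair_ge[of "sprog_code c ags \<alpha>1" "sprog_code c ags \<alpha>2"] by simp
  with SSeq show ?case unfolding sbox_sem_simps
    by (intro local_mono[OF SSeq.IH(1)[OF _ SSeq.IH(2)]]) auto
next
  case (SChoice \<alpha>1 \<alpha>2)
  have "Suc (sprog_code c ags \<alpha>1 + sprog_code c ags \<alpha>2) \<le> sprog_code c ags (SChoice \<alpha>1 \<alpha>2)"
    using pair_ge[of 2 "pair (sprog_code c ags \<alpha>1) (sprog_code c ags \<alpha>2)"]
      pair_ge[of "sprog_code c ags \<alpha>1" "sprog_code c ags \<alpha>2"] by simp
  with SChoice show ?case unfolding sbox_sem_simps
    by (intro local_conj local_mono[OF SChoice.IH(1)] local_mono[OF SChoice.IH(2)]) auto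
next
  case (STest \<phi>)
  have "fm_code c ags \<phi> \<le> sprog_code c ags (STest \<phi>)" by (simp add: pair_ge_args)
  with STest show ?case unfolding sbox_sem_simps
    by (intro local_not local_conj local_mono[OF STest.IH] local_mono[OF STest.prems(2)]) auto
next
  case (Joint \<delta>)
  then show ?case unfolding mbox_sem_simps by (intro local_mono[OF local_joint]) auto
next
  case (MSeq \<beta>1 \<beta>2)
  have "Suc (mprog_code c ags \<beta>1 + mprog_code c ags \<beta>2) \<le> mprog_code c ags (MSeq \<beta>1 \<beta>2)"
    using pair_ge[of 1 "pair (mprog_code c ags \<beta>1) (mprog_code c ags \<beta>2)"]
      pair_ge[of "mprog_code c ags \<beta>1" "mprog_code c ags \<beta>2"] by simp
  with MSeq show ?case unfolding mbox_sem_simps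
    by (intro local_mono[OF MSeq.IH(1)[OF _ MSeq.IH(2)]]) auto
next
  case (MChoice \<beta>1 \<beta>2)
  have "Suc (mprog_code c ags \<beta>1 + mprog_code c ags \<beta>2) \<le> mprog_code c ags (MChoice \<beta>1 \<beta>2)"
    using pair_ge[of 2 "pair (mprog_code c ags \<beta>1) (mprog_code c ags \<beta>2)"]
      pair_ge[of "mprog_code c ags \<beta>1" "mprog_code c ags \<beta>2"] by simp
  with MChoice show ?case unfolding mbox_sem_simps
    by (intro local_conj local_mono[OF MChoice.IH(1)] local_mono[OF MChoice.IH(2)]) auto
next
  case (MTest \<phi>)
  have "fm_code c ags \<phi> \<le> mprog_code c ags (MTest \<phi>)" by (simp add: pair_ge_args)
  with MTest show ?case unfolding mbox_sem_simps
    by (intro local_not local_conj local_mono[OF MTest.IH] local_mono[OF MTest.prems(2)]) auto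
qed

text \<open>The model is translated so that \<open>w\<close> becomes the origin, its valuation is
  cut off to finitely many stream entries, and agents out of range are put just outside radius
  \<open>N\<close>. The bounds depend only on \<open>N\<close> and the number of agents.\<close>

lemma ex_small_model:
  "\<exists>m s P. represents s P \<and> similar N N M w (P, stream_val m) (0, 0) \<and>
    m \<le> stream_bound 1 (Suc (pair (pair (N + N) (N + N)) N)) \<and>
    s \<le> stream_bound (pair (Suc N + Suc N) (Suc N + Suc N)) (length ags)"
proof -
  \<comment> \<open>An upper bound for the stream indices of all atoms with code at most
    \<open>N\<close> at positions within radius \<open>N\<close>.\<close>
  define T where "T = pair (pair (N + N) (N + N)) N"
  define ent where "ent t = (if \<exists>v p. t = pair (pos_code v) (c p) \<and>
    p \<in> snd M (fst w + fst v, snd w + snd v) then 1 else (0 :: nat))" for t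
  define m where "m = stream_code (map ent [0..<Suc T])"
  \<comment> \<open>The default \<open>(int (Suc N), 0)\<close> is out of range by one, which is why
    the bound on \<open>s\<close> uses \<open>Suc N\<close>.\<close>
  define P where "P i = (let v = offset w (fst M i) in if near N v then v else (int (Suc N), 0))"
    for i
  define s where "s = stream_code (map (\<lambda>i. pos_code (P i)) ags)"
  have "m \<le> stream_bound 1 (length (map ent [0..<Suc T]))"
    unfolding m_def by (rule stream_code_le) (auto simp: ent_def)
  then have m: "m \<le> stream_bound 1 (Suc T)" by simp
  have "near (Suc N) (P i)" for i
    by (auto simp: P_def Let_def near_def)
  then have "pos_code (P i) \<le> pair (Suc N + Suc N) (Suc N + Suc N)" for i
    by (intro pos_code_le) (simp_all only: near_def)
  then have "s \<le> stream_bound (pair (Suc N + Suc N) (Suc N + Suc N))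
      (length (map (\<lambda>i. pos_code (P i)) ags))"
    unfolding s_def by (intro stream_code_le) (simp del: add_Suc add_Suc_right)
  then have s: "s \<le> stream_bound (pair (Suc N + Suc N) (Suc N + Suc N)) (length ags)" by simp
  have rep: "represents s P"
    unfolding represents_def s_def by (simp add: snth_stream_code agent_code_less)
  have val: "p \<in> stream_val m v \<longleftrightarrow> p \<in> snd M (fst w + fst v, snd w + snd v)"
    if "near N v" "c p \<le> N" for v p
  proof -
    have "pair (pos_code v) (c p) \<le> T"
      unfolding T_def using that by (intro pair_mono pos_code_le) (auto simp: near_def)
    then have "snth (pair (pos_code v) (c p)) m = ent (pair (pos_code v) (c p))"
      unfolding m_def by (subst snth_stream_code) (auto simp del: upt_Suc)
    moreover have "ent (pair (pos_code v) (c p)) = 1 \<longleftrightarrow> p \<in> snd M (fst w + fst v, snd w + snd v)"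
      using inj_c by (auto simp: ent_def inj_eq)
    ultimately show ?thesis by (simp add: stream_val_def)
  qed
  have off: "offset (0, 0) v = v" "v = (fst w + fst (offset w v), snd w + snd (offset w v))" for v
    by (auto simp: offset_def prod_eq_iff)
  have "similar N N M w (P, stream_val m) (0, 0)"
    unfolding similar_def
  proof (intro conjI allI impI)
    fix v v' p assume "offset w v = offset (0, 0) v' \<and> near N (offset w v) \<and> c p \<le> N"
    then have "offset w v = v'" "near N v'" "c p \<le> N" by (auto simp: off(1))
    then show "p \<in> snd M v \<longleftrightarrow> p \<in> snd (P, stream_val m) v'"
      using val[of v' p] off(2)[of v] by simp
  next
    fix i
    show "offset w (fst M i) = offset (0, 0) (fst (P, stream_val m) i) \<or>
      \<not> near N (offset w (fst M i)) \<and> \<not> near N (offset (0, 0) (fst (P, stream_val m) i))"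
      by (auto simp: off(1) P_def Let_def near_def)
  qed
  with rep m s show ?thesis unfolding T_def by blast
qed

end


section \<open>The decision procedure\<close>

text \<open>A candidate \<open>q\<close> pairs a valuation stream with a placement stream. The 0
  after \<open>x\<close> codes the origin; the continuations 1 and 0 are the verdicts.\<close>

definition init :: "nat \<Rightarrow> nat \<Rightarrow> nat" where
  "init x q = cont x 0 (psnd q) 1 0"

definition state :: "nat \<Rightarrow> nat \<Rightarrow> nat \<Rightarrow> nat \<Rightarrow> nat" where
  "state n k x q = (step n (pfst q) ^^ k) (init x q)"

text \<open>With truncated subtraction, \<open>K - 1 = 0\<close> says that \<open>K\<close> is a
  verdict.\<close>

definition verdict :: "nat \<Rightarrow> nat \<Rightarrow> nat \<Rightarrow> nat" where
  "verdict n x q = state n (LEAST k. state n k x q - 1 = 0) x q"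

text \<open>Verdicts are fixed by \<open>step\<close>, so the run is constant from its first verdict
  on.\<close>

lemma verdict_unique:
  assumes "reach n (pfst q) (init x q) K" "K < 2"
  shows "verdict n x q = K"
proof -
  obtain k where k: "state n k x q = K"
    using assms(1) by (auto simp: reach_def state_def)
  let ?l = "LEAST k. state n k x q - 1 = 0"
  have "state n k x q - 1 = 0" using assms(2) k by simp
  then have l: "state n ?l x q - 1 = 0" "?l \<le> k" by (rule LeastI, rule Least_le)
  have "(step n (pfst q) ^^ j) (state n ?l x q) = state n ?l x q" for j
    using l(1) by (induction j) (auto simp: step_halt)
  from this[of "k - ?l"] have "state n (k - ?l + ?l) x q = state n ?l x q"
    by (simp add: state_def funpow_add)
  then show ?thesis using l(2) k by (simp add: verdict_def)
qed

text \<open>The regularity required for minimization, for arbitrary \<open>x\<close> and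
  \<open>q\<close> thanks to \<open>halts_all\<close>.\<close>

lemma ex_halting_state: "\<exists>k. state n k x q - 1 = 0"
proof -
  have "\<exists>K \<in> {1, 0}. reach n (pfst q) (init x q) K"
    unfolding init_def by (rule haltsD) (use halts_all in blast)
  then show ?thesis unfolding reach_def state_def by (metis diff_self_eq_0 diff_0_eq_0 empty_iff insert_iff)
qed

lemma verdict_01: "verdict n x q = 0 \<or> verdict n x q = 1"
  using LeastI_ex[OF ex_halting_state, of n x q] unfolding verdict_def by linarith

lemma computable_verdict:
  assumes "computable k a" "computable k b"
  shows "computable k (\<lambda>xs. verdict n (a xs) (b xs))"
proof -
  have state: "computable k (\<lambda>xs. state n (d xs) (a xs) (b xs))"
    if "computable k d" "computable k a" "computable k b" for k d a b
    unfolding state_def init_def cont_def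
    by (intro computable_funpow[of "step n"] computable_step computable_intros that) simp_all
  have "computable 2 (\<lambda>xs. LEAST k. (\<lambda>ys. state n (ys ! 0) (ys ! 1) (ys ! 2) - 1) (k # xs) = 0)"
  proof (rule computable_least)
    show "computable (Suc 2) (\<lambda>ys. state n (ys ! 0) (ys ! 1) (ys ! 2) - 1)"
      by (intro state computable_diff computable_nth computable_const) simp_all
  qed (use ex_halting_state in simp)
  then have "computable 2 (\<lambda>xs. LEAST k. state n k (xs ! 0) (xs ! 1) - 1 = 0)" by simp
  then have "computable 2 (\<lambda>xs. verdict n (xs ! 0) (xs ! 1))"
    unfolding verdict_def by (intro state computable_nth) simp_all
  from computable_comp2[OF this assms] show ?thesis .
qed

section \<open>Bounded search for a model\<close>

definition search_bound :: "nat \<Rightarrow> nat \<Rightarrow> nat" where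
  "search_bound n N = pair (stream_bound 1 (Suc (pair (pair (N + N) (N + N)) N)))
     (stream_bound (pair (Suc N + Suc N) (Suc N + Suc N)) n)"

text \<open>The search stops at a model or at the bound; the latter makes the minimization
  regular.\<close>

definition search_end :: "nat \<Rightarrow> nat \<Rightarrow> nat \<Rightarrow> nat" where
  "search_end n x q = (if verdict n x q = 1 then 0 else if q < search_bound n x then 1 else 0)"

text \<open>The stopping point does not tell why the search stopped, so the candidate found there is
  evaluated again.\<close>

definition search_verdict :: "nat \<Rightarrow> nat \<Rightarrow> nat" where
  "search_verdict n x = verdict n x (LEAST q. search_end n x q = 0)"

lemma search_verdict_01: "search_verdict n x = 0 \<or> search_verdict n x = 1"
  unfolding search_verdict_def by (rule verdict_01)

text \<open>The search stops no later than \<open>q\<close>. If it stops without success, it has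
  reached the bound, which is at least \<open>q\<close>, so it stops at \<open>q\<close>
  itself.\<close>

lemma search_verdict_1:
  assumes "verdict n x q = 1" "q \<le> search_bound n x"
  shows "search_verdict n x = 1"
proof -
  let ?l = "LEAST q. search_end n x q = 0"
  have q: "search_end n x q = 0" using assms(1) by (simp add: search_end_def)
  then have "search_end n x ?l = 0" "?l \<le> q" by (rule LeastI, rule Least_le)
  then have "verdict n x ?l = 1 \<or> ?l = q"
    using assms(2) by (auto simp: search_end_def split: if_splits)
  then show ?thesis using assms(1) unfolding search_verdict_def by auto
qed

lemma computable_search_verdict:
  assumes "computable k a"
  shows "computable k (\<lambda>xs. search_verdict n (a xs))"
proof -
  have "computable 1 (\<lambda>xs. LEAST q. (\<lambda>ys. search_end n (ys ! 1) (ys ! 0)) (q # xs) = 0)"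
  proof (rule computable_least)
    show "computable (Suc 1) (\<lambda>ys. search_end n (ys ! 1) (ys ! 0))"
      unfolding search_end_def search_bound_def
      by (intro computable_verdict computable_stream_bound computable_intros) simp_all
    show "\<exists>q. search_end n ((q # xs) ! 1) ((q # xs) ! 0) = 0" for xs
      by (rule exI[of _ "search_bound n (xs ! 0)"]) (simp add: search_end_def)
  qed
  then have "computable 1 (\<lambda>xs. search_verdict n (xs ! 0))"
    unfolding search_verdict_def by (intro computable_verdict computable_nth) simp_all
  from computable_comp1[OF this assms] show ?thesis .
qed

context coding
begin

lemma verdict_correct:
  assumes "represents (psnd q) P"
  shows "verdict (length ags) (fm_code c ags \<phi>) q
    = (if sat \<phi> (P, stream_val (pfst q)) (0, 0) then 1 else 0)"
proof (rule verdict_unique)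
  have "pos_code (0, 0) = 0" by (simp add: pos_code_def int_encode_if prod_encode_def)
  with decidesD[OF decides_sat assms, of "pfst q" \<phi> "(0, 0)" 1 0]
  show "reach (length ags) (pfst q) (init (fm_code c ags \<phi>) q)
      (if sat \<phi> (P, stream_val (pfst q)) (0, 0) then 1 else 0)"
    by (simp add: init_def)
qed simp

text \<open>Completeness comes from \<open>ex_small_model\<close> and locality; soundness holds
  because every candidate decodes to a genuine model.\<close>

lemma search_verdict_correct:
  "search_verdict (length ags) (fm_code c ags \<phi>) = (if satisfiable \<phi> then 1 else 0)"
proof (cases "satisfiable \<phi>")
  case True
  then obtain M w where M: "sat \<phi> M w" by (auto simp: satisfiable_def valid_def)
  let ?N = "fm_code c ags \<phi>"
  from ex_small_model[of ?N M w] obtain m s P where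
    s: "represents s P" and sim: "similar ?N ?N M w (P, stream_val m) (0, 0)" and
    le: "m \<le> stream_bound 1 (Suc (pair (pair (?N + ?N) (?N + ?N)) ?N))"
      "s \<le> stream_bound (pair (Suc ?N + Suc ?N) (Suc ?N + Suc ?N)) (length ags)"
    by blast
  have "sat \<phi> (P, stream_val m) (0, 0)"
    using local_sat[of \<phi> ?N] M sim unfolding local_def by blast
  then have "verdict (length ags) ?N (pair m s) = 1"
    using verdict_correct[of "pair m s" P \<phi>] s by simp
  moreover have "pair m s \<le> search_bound (length ags) ?N"
    unfolding search_bound_def by (intro pair_mono le)
  ultimately show ?thesis using True by (simp add: search_verdict_1)
next
  case False
  have "search_verdict (length ags) (fm_code c ags \<phi>) \<noteq> 1"
  proof
    assume "search_verdict (length ags) (fm_code c ags \<phi>) = 1"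
    then obtain q where q: "verdict (length ags) (fm_code c ags \<phi>) q = 1"
      unfolding search_verdict_def by blast
    \<comment> \<open>The placement is read off \<open>q\<close> itself, by surjectivity of
      \<open>pos_code\<close>.\<close>
    have "represents (psnd q) (\<lambda>i. inv pos_code (snth (agent_code ags i) (psnd q)))"
      by (simp add: represents_def surj_f_inv_f[OF surj_pos_code])
    from verdict_correct[OF this, of \<phi>] q False show False
      by (auto simp: satisfiable_def valid_def split: if_splits)
  qed
  then show ?thesis using False search_verdict_01[of "length ags" "fm_code c ags \<phi>"] by simp
qed

end

theorem theorem8:
  fixes c :: "'atm \<Rightarrow> nat" and ags :: "'agt::finite list"
  assumes "inj c" and "distinct ags" and "set ags = UNIV"
  shows "decidable (fm_code c ags) satisfiable \<and> decidable (fm_code c ags) valid"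
proof -
  interpret coding c ags using assms by unfold_locales
  let ?n = "length ags"
  have sat: "search_verdict ?n (fm_code c ags \<phi>) = (if satisfiable \<phi> then 1 else 0)"
    for \<phi> :: "('atm, 'agt) fm"
    by (rule search_verdict_correct)
  \<comment> \<open>\<open>pair 2\<close> forms the code of a negation: validity is unsatisfiability
    of the negated formula.\<close>
  have "computable 1 (\<lambda>xs. search_verdict ?n (xs ! 0))"
    "computable 1 (\<lambda>xs. 1 - search_verdict ?n (pair 2 (xs ! 0)))"
    by (intro computable_search_verdict computable_intros; simp)+
  then obtain f g where f: "recursive_fn 1 f" "\<And>x. f [x] = search_verdict ?n x"
    and g: "recursive_fn 1 g" "\<And>x. g [x] = 1 - search_verdict ?n (pair 2 x)"
    unfolding computable_def by force
  have "g [fm_code c ags \<phi>] = (if valid \<phi> then 1 else 0)" for \<phi> :: "('atm, 'agt) fm"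
    using g(2)[of "fm_code c ags \<phi>"] sat[of "Neg \<phi>"] by (simp add: satisfiable_def valid_def)
  with f g(1) sat show ?thesis unfolding decidable_def by metis
qed

end
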